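(* If $f\in\mathfrak{D}$ and $\mathcal{Z}(f^* )$ has positive logarithmic capacity, then $f$ is not cyclic in $\mathfrak{D}$.
   Context: $\mathfrak{D}=\mathfrak{D}_1$ is the Dirichlet space of the bidisk: the Hilbert space of holomorphic functions $f(z_1,z_2)=\sum_{k,l\ge0}a_{k,l}z_1^kz_2^l$ on $\mathbb{D}^2$ with $\|f\|_1^2=\sum_{k,l\ge0}(k+1)(l+1)|a_{k,l}|^2<\infty$. A function $f\in\mathfrak{D}$ is cyclic if the closed linear span of $\{z_1^kz_2^lf: k,l\ge0\}$ is all of $\mathfrak{D}$; equivalently, there are polynomials $p_n$ in two variables with $\|p_nf-1\|_1\to0$. Let $E\subset\mathbb{T}^2$ be a Borel set. A probability measure $\mu$ supported in $E$ has finite logarithmic energy if $$I[\mu]=\int_{\mathbb{T}^2}\int_{\mathbb{T}^2}\log\frac{e}{|e^{i\theta_1}-e^{i\vartheta_1}|}\,\log\frac{e}{|e^{i\theta_2}-e^{i\vartheta_2}|}\,d\mu(\theta_1,\theta_2)\,d\mu(\vartheta_1,\vartheta_2)<\infty.$$ If $E$ supports no such measure, $E$ has logarithmic capacity $0$; otherwise $E$ has positive logarithmic capacity. For $f\in\mathfrak{D}$, the radial limit $f^*(e^{i\theta_1},e^{i\theta_2})=\lim_{r\to1^-}f(re^{i\theta_1},re^{i\theta_2})$ exists at all points of $\mathbb{T}^2$ outside a set of logarithmic capacity $0$ (a known fact). $\mathcal{Z}(f^* )$ denotes the set of points of $\mathbb{T}^2$ at which $f^*$ exists and equals $0$. *)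

theory Defs
  imports "HOL-Probability.Probability"
begin

definition bidisk :: "(complex \<times> complex) set" where
  "bidisk = ball 0 1 \<times> ball 0 1"

definition torus :: "(complex \<times> complex) set" where
  "torus = sphere 0 1 \<times> sphere 0 1"

text \<open>Functions on the bidisk are total functions whose values outside \<^term>\<open>bidisk\<close> are
  irrelevant. A function that has an expansion in the following sense is holomorphic on the
  bidisk, and every holomorphic function there has one.\<close>

definition has_bidisk_expansion ::
  "(complex \<times> complex \<Rightarrow> complex) \<Rightarrow> (nat \<Rightarrow> nat \<Rightarrow> complex) \<Rightarrow> bool" where
  "has_bidisk_expansion f a \<longleftrightarrow>
     (\<forall>z\<in>bidisk. ((\<lambda>(k, l). a k l * fst z ^ k * snd z ^ l) has_sum f z) UNIV)"

lemma disk_powser_zero_imp_zero: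
  fixes c :: "nat \<Rightarrow> complex"
  assumes "\<And>z. norm z < 1 \<Longrightarrow> ((\<lambda>n. c n * z ^ n) has_sum 0) UNIV"
  shows "c n = 0"
proof -
  have s: "(\<lambda>n. c n * z ^ n) sums 0" if "norm z < 1" for z
    using assms[OF that] by (rule has_sum_imp_sums)
  have "conv_radius c \<ge> norm (1/2 :: complex)"
    using s[of "1/2"] by (intro conv_radius_geI) (auto simp: sums_iff)
  then have r: "fps_conv_radius (Abs_fps c) > 0"
    unfolding fps_conv_radius_def
    by (simp add: Abs_fps_inverse less_le_trans[of 0 "ereal (1/2)"])
  have "eventually (\<lambda>z. z \<in> ball 0 1) (nhds (0::complex))"
    by (rule eventually_nhds_in_open) auto
  then have "eventually (\<lambda>z. eval_fps (Abs_fps c) z = eval_fps 0 z) (nhds 0)"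
    by eventually_elim (use s in \<open>auto simp: eval_fps_def sums_iff\<close>)
  then have "Abs_fps c = 0"
    using r by (intro eval_fps_eqD) auto
  then show ?thesis
    by (metis fps_nth_Abs_fps fps_zero_nth)
qed

lemma has_bidisk_expansion_unique:
  assumes "has_bidisk_expansion f a" "has_bidisk_expansion f b"
  shows "a = b"
proof -
  define c where "c = (\<lambda>k l. a k l - b k l)"
  have sum0: "((\<lambda>(k, l). c k l * z ^ k * w ^ l) has_sum 0) (UNIV \<times> UNIV)"
    if "norm z < 1" "norm w < 1" for z w
  proof -
    have zw: "(z, w) \<in> bidisk" using that by (auto simp: bidisk_def)
    have "((\<lambda>x. (\<lambda>(k, l). a k l * z ^ k * w ^ l) x + - (\<lambda>(k, l). b k l * z ^ k * w ^ l) x)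
            has_sum (f (z, w) + - f (z, w))) UNIV"
      using bspec[OF assms(1)[unfolded has_bidisk_expansion_def] zw]
            bspec[OF assms(2)[unfolded has_bidisk_expansion_def] zw]
      by (intro has_sum_add) (simp_all add: has_sum_uminus)
    then show ?thesis
      by (simp add: c_def case_prod_unfold algebra_simps)
  qed
  define h where "h = (\<lambda>w k. \<Sum>\<^sub>\<infinity>l. c k l * w ^ l)"
  have row: "((\<lambda>l. c k l * w ^ l) has_sum h w k) UNIV" if "norm w < 1" for w k
  proof -
    have "(\<lambda>(k, l). c k l * (1/2) ^ k * w ^ l) summable_on (UNIV \<times> UNIV)"
      using sum0[of "1/2" w] that by (auto simp: summable_on_def)
    then have "(\<lambda>l. c k l * (1/2) ^ k * w ^ l) summable_on UNIV"
      by (rule summable_on_SigmaD1) auto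
    then have "(\<lambda>l. 2 ^ k * (c k l * (1/2) ^ k * w ^ l)) summable_on UNIV"
      by (rule summable_on_cmult_right)
    then have "(\<lambda>l. c k l * w ^ l) summable_on UNIV"
      by (simp add: field_simps)
    then show ?thesis unfolding h_def by (rule has_sum_infsum)
  qed
  have "h w k = 0" if "norm w < 1" for w k
  proof (rule disk_powser_zero_imp_zero[of "h w"])
    fix z :: complex assume z: "norm z < 1"
    have "((\<lambda>k. z ^ k * h w k) has_sum 0) UNIV"
    proof (rule has_sum_SigmaD[OF sum0[OF z that]])
      fix k
      show "((\<lambda>l. case (k, l) of (k, l) \<Rightarrow> c k l * z ^ k * w ^ l) has_sum z ^ k * h w k) UNIV"
        using has_sum_cmult_right[OF row[OF that, of k], of "z ^ k"] by (simp add: mult_ac)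
    qed
    then show "((\<lambda>k. h w k * z ^ k) has_sum 0) UNIV"
      by (simp add: mult_ac)
  qed
  then have "c k l = 0" for k l
    using disk_powser_zero_imp_zero[of "c k" l] row by metis
  then show ?thesis by (auto simp: c_def fun_eq_iff)
qed

definition bidisk_coeff :: "(complex \<times> complex \<Rightarrow> complex) \<Rightarrow> nat \<Rightarrow> nat \<Rightarrow> complex" where
  "bidisk_coeff f = (THE a. has_bidisk_expansion f a)"

lemma bidisk_coeff_eq: "has_bidisk_expansion f a \<Longrightarrow> bidisk_coeff f = a"
  unfolding bidisk_coeff_def by (blast intro: the_equality has_bidisk_expansion_unique)

definition dirichlet_space :: "(complex \<times> complex \<Rightarrow> complex) set" where
  "dirichlet_space = {f. \<exists>a. has_bidisk_expansion f a \<and>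
     (\<lambda>(k, l). real (k + 1) * real (l + 1) * (cmod (a k l))\<^sup>2) summable_on UNIV}"

definition dirichlet_norm :: "(complex \<times> complex \<Rightarrow> complex) \<Rightarrow> real" where
  "dirichlet_norm f =
     sqrt (\<Sum>\<^sub>\<infinity>(k, l). real (k + 1) * real (l + 1) * (cmod (bidisk_coeff f k l))\<^sup>2)"

definition complex_span :: "('a \<Rightarrow> complex) set \<Rightarrow> ('a \<Rightarrow> complex) set" where
  "complex_span S = {\<lambda>z. \<Sum>h\<in>T. c h * h z | T c. finite T \<and> T \<subseteq> S}"

definition dirichlet_closure ::
  "(complex \<times> complex \<Rightarrow> complex) set \<Rightarrow> (complex \<times> complex \<Rightarrow> complex) set" where
  "dirichlet_closure S =
     {g \<in> dirichlet_space. \<forall>\<epsilon>>0. \<exists>h\<in>S. dirichlet_norm (\<lambda>z. h z - g z) < \<epsilon>}"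

definition dirichlet_cyclic :: "(complex \<times> complex \<Rightarrow> complex) \<Rightarrow> bool" where
  "dirichlet_cyclic f \<longleftrightarrow> f \<in> dirichlet_space \<and>
     dirichlet_closure (complex_span {\<lambda>z. fst z ^ k * snd z ^ l * f z | k l. True})
       = dirichlet_space"

text \<open>On the diagonal the kernel is infinite; this has to be said explicitly, since
  \<^term>\<open>ln (exp 1 / 0) = (0::real)\<close> in HOL. On the unit circle \<^term>\<open>dist z w \<le> 2\<close>, so the
  logarithm is positive there and the conversion to \<^typ>\<open>ennreal\<close> loses nothing.\<close>

definition log_kernel :: "complex \<Rightarrow> complex \<Rightarrow> ennreal" where
  "log_kernel z w = (if z = w then \<infinity> else ennreal (ln (exp 1 / dist z w)))"

definition log_energy :: "(complex \<times> complex) measure \<Rightarrow> ennreal" where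
  "log_energy \<mu> =
     (\<integral>\<^sup>+\<zeta>. (\<integral>\<^sup>+\<eta>. log_kernel (fst \<zeta>) (fst \<eta>) * log_kernel (snd \<zeta>) (snd \<eta>) \<partial>\<mu>) \<partial>\<mu>)"

text \<open>To be used for Borel sets \<open>E \<subseteq> torus\<close>. That \<open>\<mu>\<close> is supported in \<open>E\<close> means that it gives
  \<open>E\<close> full mass.\<close>

definition positive_log_capacity :: "(complex \<times> complex) set \<Rightarrow> bool" where
  "positive_log_capacity E \<longleftrightarrow>
     (\<exists>\<mu>. prob_space \<mu> \<and> sets \<mu> = sets borel \<and> emeasure \<mu> E = 1 \<and> log_energy \<mu> < \<infinity>)"

definition radial_zero_set ::
  "(complex \<times> complex \<Rightarrow> complex) \<Rightarrow> (complex \<times> complex) set" where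
  "radial_zero_set f =
     {\<zeta> \<in> torus. ((\<lambda>r. f (of_real r * fst \<zeta>, of_real r * snd \<zeta>)) \<longlongrightarrow> 0) (at_left (1::real))}"

end

(* Let mu be a probability measure of finite logarithmic energy on the zero set of f*. The Abel
   means 1 - ln |1 - r u| of the logarithmic kernel have the Fourier coefficients r^|k| / (2 |k|)
   for k /= 0 and are dominated by a multiple of the kernel, so finite energy yields that the sum of
   |mu^(k,l)|^2 / ((k+1)(l+1)) over k, l >= 0 is finite. To stay with power series in z1, z2 and
   z1, cnj z2, the product of two real parts is written as
   Re A * Re B = (Re (A B) + Re (A cnj B)) / 2, where both terms contribute nonnegatively.
   By Cauchy-Schwarz the functionals g |-> int g(r zeta) dmu are bounded on the Dirichlet space,
   uniformly in r < 1. After restricting mu to a set of positive measure on which f(r_n zeta) is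
   bounded in n, they tend to 0 on polynomial multiples of f as r = r_n -> 1, whereas on the
   constant 1 they equal the total mass. Hence 1 is not in the closure of these multiples. *)
theory Submission
  imports Defs
begin

section \<open>Closure properties of the Dirichlet space\<close>

lemma dirichlet_spaceI:
  assumes "has_bidisk_expansion f a"
    and "(\<lambda>(k, l). real (k + 1) * real (l + 1) * (cmod (a k l))\<^sup>2) summable_on UNIV"
  shows "f \<in> dirichlet_space"
  using assms unfolding dirichlet_space_def by blast

lemma one_in_dirichlet_space: "(\<lambda>z. 1) \<in> dirichlet_space"
proof (rule dirichlet_spaceI)
  let ?a = "\<lambda>k l. if k = 0 \<and> l = 0 then 1 else 0 :: complex"
  have "((\<lambda>(k, l). ?a k l * fst z ^ k * snd z ^ l) has_sum 1) UNIV" for z :: "complex \<times> complex"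
    by (subst has_sum_cong_neutral[where T = "{(0, 0)}" and g = "\<lambda>_. 1"])
       (auto intro: has_sum_finiteI split: if_splits)
  then show "has_bidisk_expansion (\<lambda>z. 1) ?a"
    unfolding has_bidisk_expansion_def by blast
  show "(\<lambda>(k, l). real (k + 1) * real (l + 1) * (cmod (?a k l))\<^sup>2) summable_on UNIV"
    by (subst summable_on_cong_neutral[where T = "{(0, 0)}" and g = "\<lambda>_. 1"])
       (auto split: if_splits)
qed

lemma dirichlet_space_add:
  assumes "f \<in> dirichlet_space" "g \<in> dirichlet_space"
  shows "(\<lambda>z. f z + g z) \<in> dirichlet_space"
proof -
  from assms obtain a b where
    a: "has_bidisk_expansion f a"
    and sa: "(\<lambda>(k, l). real (k + 1) * real (l + 1) * (cmod (a k l))\<^sup>2) summable_on UNIV"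
    and b: "has_bidisk_expansion g b"
    and sb: "(\<lambda>(k, l). real (k + 1) * real (l + 1) * (cmod (b k l))\<^sup>2) summable_on UNIV"
    unfolding dirichlet_space_def by blast
  show ?thesis
  proof (rule dirichlet_spaceI)
    show "has_bidisk_expansion (\<lambda>z. f z + g z) (\<lambda>k l. a k l + b k l)"
      unfolding has_bidisk_expansion_def
    proof
      fix z assume "z \<in> bidisk"
      then show "((\<lambda>(k, l). (a k l + b k l) * fst z ^ k * snd z ^ l) has_sum f z + g z) UNIV"
        using has_sum_add[of "\<lambda>(k, l). a k l * fst z ^ k * snd z ^ l" UNIV "f z"
            "\<lambda>(k, l). b k l * fst z ^ k * snd z ^ l" "g z"] a b
        by (simp add: has_bidisk_expansion_def case_prod_unfold algebra_simps)
    qed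
    have sq: "(cmod (x + y))\<^sup>2 \<le> 2 * (cmod x)\<^sup>2 + 2 * (cmod y)\<^sup>2" for x y
    proof -
      have "(cmod (x + y))\<^sup>2 \<le> (cmod x + cmod y)\<^sup>2"
        by (intro power_mono norm_triangle_ineq) auto
      also have "\<dots> \<le> 2 * (cmod x)\<^sup>2 + 2 * (cmod y)\<^sup>2"
        using zero_le_power2[of "cmod x - cmod y"] by (simp add: power2_eq_square algebra_simps)
      finally show ?thesis .
    qed
    show "(\<lambda>(k, l). real (k + 1) * real (l + 1) * (cmod (a k l + b k l))\<^sup>2) summable_on UNIV"
    proof (rule summable_on_comparison_test)
      show "(\<lambda>x. 2 * (case x of (k, l) \<Rightarrow> real (k + 1) * real (l + 1) * (cmod (a k l))\<^sup>2)
              + 2 * (case x of (k, l) \<Rightarrow> real (k + 1) * real (l + 1) * (cmod (b k l))\<^sup>2))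
              summable_on UNIV"
        using sa sb by (intro summable_on_add summable_on_cmult_right)
      show "(case x of (k, l) \<Rightarrow> real (k + 1) * real (l + 1) * (cmod (a k l + b k l))\<^sup>2)
          \<le> 2 * (case x of (k, l) \<Rightarrow> real (k + 1) * real (l + 1) * (cmod (a k l))\<^sup>2)
              + 2 * (case x of (k, l) \<Rightarrow> real (k + 1) * real (l + 1) * (cmod (b k l))\<^sup>2)" for x
      proof (cases x)
        case (Pair k l)
        have "real (k + 1) * real (l + 1) * (cmod (a k l + b k l))\<^sup>2
            \<le> real (k + 1) * real (l + 1) * (2 * (cmod (a k l))\<^sup>2 + 2 * (cmod (b k l))\<^sup>2)"
          by (intro mult_left_mono sq) auto
        then show ?thesis by (simp add: Pair algebra_simps)
      qed
    qed auto
  qed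
qed

lemma dirichlet_space_cmult:
  assumes "f \<in> dirichlet_space"
  shows "(\<lambda>z. c * f z) \<in> dirichlet_space"
proof -
  from assms obtain a where
    a: "has_bidisk_expansion f a"
    and sa: "(\<lambda>(k, l). real (k + 1) * real (l + 1) * (cmod (a k l))\<^sup>2) summable_on UNIV"
    unfolding dirichlet_space_def by blast
  show ?thesis
  proof (rule dirichlet_spaceI)
    show "has_bidisk_expansion (\<lambda>z. c * f z) (\<lambda>k l. c * a k l)"
      unfolding has_bidisk_expansion_def
    proof
      fix z assume "z \<in> bidisk"
      then show "((\<lambda>(k, l). c * a k l * fst z ^ k * snd z ^ l) has_sum c * f z) UNIV"
        using has_sum_cmult_right[of "\<lambda>(k, l). a k l * fst z ^ k * snd z ^ l" UNIV "f z" c] a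
        by (simp add: has_bidisk_expansion_def case_prod_unfold mult.assoc)
    qed
    show "(\<lambda>(k, l). real (k + 1) * real (l + 1) * (cmod (c * a k l))\<^sup>2) summable_on UNIV"
      using summable_on_cmult_right[OF sa, of "(cmod c)\<^sup>2"]
      by (simp add: case_prod_unfold norm_mult power_mult_distrib mult_ac)
  qed
qed

lemma dirichlet_space_sum:
  assumes "finite T" "\<And>h. h \<in> T \<Longrightarrow> F h \<in> dirichlet_space"
  shows "(\<lambda>z. \<Sum>h\<in>T. F h z) \<in> dirichlet_space"
  using assms
proof (induction T rule: finite_induct)
  case empty
  then show ?case
    using dirichlet_space_cmult[OF one_in_dirichlet_space, of 0] by simp
next
  case (insert h T)
  then show ?case
    using dirichlet_space_add[of "F h" "\<lambda>z. \<Sum>h\<in>T. F h z"] by simp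
qed

text \<open>The coefficients move by \<open>(i, j)\<close> and vanish off the shifted quadrant, so
  both sums reindex along the injection \<open>s\<close>. The weights grow at most by the factor
  \<open>(i + 1) * (j + 1)\<close>, because
  \<open>k + i + 1 \<le> (i + 1) * (k + 1)\<close>.\<close>

lemma dirichlet_space_monomial_mult:
  assumes "f \<in> dirichlet_space"
  shows "(\<lambda>z. fst z ^ i * snd z ^ j * f z) \<in> dirichlet_space"
proof -
  from assms obtain a where
    a: "has_bidisk_expansion f a"
    and sa: "(\<lambda>(k, l). real (k + 1) * real (l + 1) * (cmod (a k l))\<^sup>2) summable_on UNIV"
    unfolding dirichlet_space_def by blast
  define b where "b k l = (if i \<le> k \<and> j \<le> l then a (k - i) (l - j) else 0)" for k l
  define s where "s = (\<lambda>(k, l). (k + i, l + j))"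
  have inj: "inj s" by (auto simp: s_def inj_def)
  have range: "(k, l) \<in> range s \<longleftrightarrow> i \<le> k \<and> j \<le> l" for k l
    by (auto simp: s_def intro!: image_eqI[of _ _ "(k - i, l - j)"])
  show ?thesis
  proof (rule dirichlet_spaceI)
    show "has_bidisk_expansion (\<lambda>z. fst z ^ i * snd z ^ j * f z) b"
      unfolding has_bidisk_expansion_def
    proof
      fix z assume z: "z \<in> bidisk"
      define u where "u = (\<lambda>(k, l). b k l * fst z ^ k * snd z ^ l)"
      have "((\<lambda>x. fst z ^ i * snd z ^ j * (\<lambda>(k, l). a k l * fst z ^ k * snd z ^ l) x)
          has_sum fst z ^ i * snd z ^ j * f z) UNIV"
        using a z by (intro has_sum_cmult_right) (auto simp: has_bidisk_expansion_def)
      also have "(\<lambda>x. fst z ^ i * snd z ^ j * (\<lambda>(k, l). a k l * fst z ^ k * snd z ^ l) x) = u \<circ> s"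
        by (auto simp: fun_eq_iff u_def s_def b_def power_add mult_ac)
      finally have "(u has_sum fst z ^ i * snd z ^ j * f z) (range s)"
        using has_sum_reindex[OF inj] by blast
      then show "(u has_sum fst z ^ i * snd z ^ j * f z) UNIV"
        by (subst has_sum_cong_neutral[where T = "range s" and g = u])
           (auto simp: u_def b_def range)
    qed
    define v where "v = (\<lambda>(k, l). real (k + 1) * real (l + 1) * (cmod (b k l))\<^sup>2)"
    have "v \<circ> s summable_on UNIV"
    proof (rule summable_on_comparison_test)
      show "(\<lambda>x. real (i + 1) * real (j + 1) *
          (case x of (k, l) \<Rightarrow> real (k + 1) * real (l + 1) * (cmod (a k l))\<^sup>2)) summable_on UNIV"
        using sa by (rule summable_on_cmult_right)
      show "(v \<circ> s) x \<le> real (i + 1) * real (j + 1) *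
          (case x of (k, l) \<Rightarrow> real (k + 1) * real (l + 1) * (cmod (a k l))\<^sup>2)" for x
      proof (cases x)
        case (Pair k l)
        have "real (k + i + 1) * real (l + j + 1)
            \<le> (real (i + 1) * real (k + 1)) * (real (j + 1) * real (l + 1))"
          by (intro mult_mono) (auto simp: algebra_simps)
        then have "real (k + i + 1) * real (l + j + 1) * (cmod (a k l))\<^sup>2
            \<le> (real (i + 1) * real (k + 1)) * (real (j + 1) * real (l + 1)) * (cmod (a k l))\<^sup>2"
          by (rule mult_right_mono) auto
        then show ?thesis
          by (simp add: Pair v_def s_def b_def mult_ac)
      qed
      show "0 \<le> (v \<circ> s) x" for x
        by (cases x) (auto simp: v_def s_def)
    qed
    then have "v summable_on range s"
      using summable_on_reindex[OF inj] by blast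
    then show "v summable_on UNIV"
      by (subst summable_on_cong_neutral[where T = "range s" and g = v])
         (auto simp: v_def b_def range)
  qed
qed

section \<open>Abel means of the logarithmic kernel\<close>

text \<open>Taylor coefficients of \<open>1 - ln (1 - z)\<close>; the value at 0 is the constant
  that the \<open>e\<close> contributes to \<open>log (e / |z - w|)\<close>.\<close>

definition log_coeff :: "nat \<Rightarrow> real" where
  "log_coeff n = (if n = 0 then 1 else 1 / real n)"

definition log_poly :: "real \<Rightarrow> nat \<Rightarrow> complex \<Rightarrow> complex" where
  "log_poly r N u = (\<Sum>k<N. of_real (log_coeff k * r ^ k) * u ^ k)"

text \<open>For \<open>u = z * cnj w\<close> with \<open>z\<close> and \<open>w\<close> on the
  circle, \<open>|1 - u| = |z - w|\<close>, so \<open>r = 1\<close> would give the logarithmic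
  kernel off the diagonal; \<open>r < 1\<close> removes the singularity.\<close>

definition abel_log_kernel :: "real \<Rightarrow> complex \<Rightarrow> real" where
  "abel_log_kernel r u = 1 - ln (cmod (1 - of_real r * u))"

text \<open>The lower bound produces the reciprocal Dirichlet weights in
  \<open>moment_sum_le_log_energy\<close>; the upper one allows the geometric majorant in
  \<open>norm_log_poly_le\<close>.\<close>

lemma log_coeff_bounds: "1 / real (n + 1) \<le> log_coeff n" "0 \<le> log_coeff n" "log_coeff n \<le> 1"
  by (auto simp: log_coeff_def field_simps)

lemma borel_measurable_log_poly: "log_poly r N \<in> borel_measurable borel"
  unfolding log_poly_def by (intro borel_measurable_continuous_onI continuous_intros)

lemma borel_measurable_abel_log_kernel: "abel_log_kernel r \<in> borel_measurable borel"
  unfolding abel_log_kernel_def by measurable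

lemma log_poly_tendsto:
  assumes "0 \<le> r" "r < 1" "cmod u \<le> 1"
  shows "(\<lambda>N. Re (log_poly r N u)) \<longlonglongrightarrow> abel_log_kernel r u"
proof -
  define z where "z = of_real r * u"
  have z: "cmod z < 1"
    using assms mult_left_le[of "cmod u" r] by (auto simp: z_def norm_mult)
  \<comment> \<open>At \<open>n = 0\<close> the logarithm series contributes a division by zero,
    which is 0 in HOL, so the constant 1 takes exactly that place.\<close>
  have "(\<lambda>n. (if n = 0 then 1 else 0) - (- (z ^ n) / of_nat n)) sums (1 - ln (1 + - z))"
    using sums_single[of 0 "\<lambda>_. 1::complex"] Ln_series'[of "- z"] z
    by (intro sums_diff) (auto simp: if_distrib cong: if_cong)
  also have "(\<lambda>n. (if n = 0 then 1 else 0) - (- (z ^ n) / of_nat n))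
      = (\<lambda>k. of_real (log_coeff k * r ^ k) * u ^ k)"
    by (auto simp: fun_eq_iff log_coeff_def z_def power_mult_distrib)
  finally have "(\<lambda>N. Re (log_poly r N u)) \<longlonglongrightarrow> Re (1 - ln (1 + - z))"
    unfolding sums_def log_poly_def by (intro tendsto_Re)
  \<comment> \<open>The real part of the complex logarithm is the logarithm of the modulus only away
    from 0.\<close>
  moreover have "1 - z \<noteq> 0" using z by auto
  ultimately show ?thesis by (simp add: abel_log_kernel_def z_def)
qed

text \<open>The geometric series is a majorant. The bound depends neither on \<open>N\<close> nor on
  \<open>u\<close>, so for fixed \<open>r\<close> it can serve as dominating constant in
  \<open>abel_energy_ge\<close>.\<close>

lemma norm_log_poly_le:
  assumes "0 \<le> r" "r < 1" "cmod u \<le> 1"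
  shows "cmod (log_poly r N u) \<le> 1 / (1 - r)"
proof -
  have "cmod (log_poly r N u) \<le> (\<Sum>k<N. r ^ k)"
    unfolding log_poly_def
  proof (rule order_trans[OF norm_sum sum_mono])
    fix k
    have "(log_coeff k * r ^ k) * cmod u ^ k \<le> (1 * r ^ k) * 1"
      using assms log_coeff_bounds by (intro mult_mono power_le_one) auto
    then show "cmod (of_real (log_coeff k * r ^ k) * u ^ k) \<le> r ^ k"
      using assms log_coeff_bounds[of k] by (simp add: norm_mult norm_power)
  qed
  also have "\<dots> \<le> (\<Sum>k. r ^ k)"
    using assms by (intro sum_le_suminf summable_geometric) auto
  finally show ?thesis
    using assms by (simp add: suminf_geometric)
qed

text \<open>The modulus of \<open>1 - r * u\<close> is at most 2, and
  \<open>ln 2 < 1\<close>.\<close>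

lemma abel_log_kernel_nonneg:
  assumes "0 \<le> r" "r < 1" "cmod u \<le> 1"
  shows "0 \<le> abel_log_kernel r u"
proof -
  have ru: "r * cmod u < 1" using assms mult_left_le[of "cmod u" r] by auto
  have "cmod (1 - of_real r * u) \<le> 1 + r * cmod u"
    using norm_triangle_ineq4[of 1 "of_real r * u"] assms by (simp add: norm_mult)
  then have "cmod (1 - of_real r * u) \<le> 2" using ru by simp
  moreover have "cmod (of_real r * u) < 1"
    using ru assms by (simp add: norm_mult)
  then have "0 < cmod (1 - of_real r * u)" by auto
  ultimately have "ln (cmod (1 - of_real r * u)) \<le> ln 2" by simp
  then show ?thesis using ln2_le_25_over_36 by (simp add: abel_log_kernel_def)
qed

text \<open>For \<open>z, w\<close> on the circle \<open>\<bar>z - w\<bar> \<le> 2 * \<bar>1 - r z cnj w\<bar>\<close>, so the Abel means exceed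
  the kernel by at most \<open>ln 2\<close>, which is absorbed since the kernel is at least \<open>1 - ln 2 > 0\<close>.\<close>

lemma abel_log_kernel_le_log_kernel:
  assumes r: "0 \<le> r" "r < 1" and z: "cmod z = 1" "cmod w = 1"
  shows "ennreal (abel_log_kernel r (z * cnj w) / 4) \<le> log_kernel z w"
proof (cases "z = w")
  case False
  define u where "u = z * cnj w"
  have u: "cmod u = 1" using z by (simp add: u_def norm_mult)
  have "w * cnj w = 1" using z by (simp add: complex_norm_square[symmetric])
  then have "z - w = - ((1 - u) * w)" by (simp add: u_def algebra_simps)
  then have d: "dist z w = cmod (1 - u)" using z by (simp add: dist_norm norm_mult)
  \<comment> \<open>The point \<open>r * u\<close> has distance \<open>1 - r\<close> from
    \<open>u\<close>, and no point of the circle, in particular 1, is closer to it.\<close>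
  have "cmod (1 - u) \<le> cmod (1 - of_real r * u) + cmod (of_real r * u - u)"
    by norm
  also have "of_real r * u - u = of_real (r - 1) * u" by (simp add: algebra_simps)
  also have "cmod \<dots> = 1 - cmod (of_real r * u)" using u r by (simp add: norm_mult del: of_real_diff)
  also have "\<dots> \<le> cmod (1 - of_real r * u)"
    using norm_triangle_ineq2[of 1 "of_real r * u"] by simp
  finally have le: "dist z w \<le> 2 * cmod (1 - of_real r * u)" by (simp add: d)
  have pos: "0 < dist z w" using False by simp
  have "ln (dist z w) \<le> ln (2 * cmod (1 - of_real r * u))"
    using le pos by (subst ln_le_cancel_iff) auto
  also have "\<dots> = ln 2 + ln (cmod (1 - of_real r * u))"
    using le pos by (intro ln_mult_pos) auto
  finally have 1: "ln (dist z w) \<le> ln 2 + ln (cmod (1 - of_real r * u))" .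
  have "dist z w \<le> 2" using u norm_triangle_ineq4[of 1 u] by (simp add: d)
  then have "ln (dist z w) \<le> ln 2" using pos by simp
  \<comment> \<open>With \<open>L = ln (dist z w)\<close> the claim follows from
    \<open>1 + ln 2 - L \<le> 4 * (1 - L)\<close>, that is \<open>3 * L \<le> 3 - ln 2\<close>. As
    \<open>L \<le> ln 2\<close>, it suffices that \<open>ln 2 \<le> 3 / 4\<close>; this is where the
    constant 4 comes from.\<close>
  then have "abel_log_kernel r u / 4 \<le> 1 - ln (dist z w)"
    using 1 ln2_le_25_over_36 by (simp add: abel_log_kernel_def)
  also have "\<dots> = ln (exp 1 / dist z w)"
    using pos False by (simp add: ln_div)
  finally show ?thesis
    using False by (auto simp: log_kernel_def u_def intro!: ennreal_leI)
qed (simp add: log_kernel_def)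

section \<open>Fourier coefficients and energy of measures on the torus\<close>

text \<open>On the torus this is the Fourier coefficient of \<open>\<nu>\<close> at
  \<open>(-k, -l)\<close>, written with powers so that it pairs directly with power series
  coefficients.\<close>

definition torus_moment :: "(complex \<times> complex) measure \<Rightarrow> nat \<Rightarrow> nat \<Rightarrow> complex" where
  "torus_moment \<nu> k l = (\<integral>\<zeta>. fst \<zeta> ^ k * snd \<zeta> ^ l \<partial>\<nu>)"

lemma borel_measurable_cnj [measurable]: "cnj \<in> borel_measurable borel"
  by (intro borel_measurable_continuous_onI continuous_intros)

lemma Re_mult_Re: "Re s * Re t = (Re (s * t) + Re (s * cnj t)) / 2"
  by simp

lemma torus_borel [measurable]: "torus \<in> sets borel"
  unfolding torus_def by (intro borel_closed closed_Times closed_sphere)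

text \<open>Finite total mass is the right generality here: the measure used in the end is a
  restriction of a probability measure.\<close>

locale torus_measure = finite_measure \<nu> for \<nu> :: "(complex \<times> complex) measure" +
  assumes sets_eq [measurable_cong]: "sets \<nu> = sets borel"
    and AE_torus: "AE \<zeta> in \<nu>. \<zeta> \<in> torus"
begin

lemma space_eq [simp]: "space \<nu> = UNIV"
  using sets_eq_imp_space_eq[OF sets_eq] by simp

lemma integrable_bounded_on_torus:
  fixes F :: "complex \<times> complex \<Rightarrow> 'b::{banach, second_countable_topology}"
  assumes "F \<in> borel_measurable borel" "\<And>\<zeta>. \<zeta> \<in> torus \<Longrightarrow> norm (F \<zeta>) \<le> B"
  shows "integrable \<nu> F"
  by (rule integrable_const_bound[where B = B])
     (use AE_torus assms in \<open>auto elim: eventually_mono simp: measurable_cong_sets[OF sets_eq refl]\<close>)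

sublocale PP: pair_sigma_finite \<nu> \<nu> ..

lemma AE_torus_pair: "AE x in \<nu> \<Otimes>\<^sub>M \<nu>. fst x \<in> torus \<and> snd x \<in> torus"
proof (rule PP.AE_pair_measure)
  have [measurable]: "torus \<in> sets \<nu>" by (simp add: sets_eq torus_borel)
  show "{x \<in> space (\<nu> \<Otimes>\<^sub>M \<nu>). fst x \<in> torus \<and> snd x \<in> torus} \<in> sets (\<nu> \<Otimes>\<^sub>M \<nu>)"
    by measurable
  show "AE x in \<nu>. AE y in \<nu>. fst (x, y) \<in> torus \<and> snd (x, y) \<in> torus"
    using AE_torus by (auto elim!: eventually_mono)
qed

lemma integrable_pair_bounded_on_torus:
  fixes F :: "(complex \<times> complex) \<times> (complex \<times> complex) \<Rightarrow> 'b::{banach, second_countable_topology}"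
  assumes "F \<in> borel_measurable (\<nu> \<Otimes>\<^sub>M \<nu>)"
    and "\<And>\<zeta> \<eta>. \<zeta> \<in> torus \<Longrightarrow> \<eta> \<in> torus \<Longrightarrow> norm (F (\<zeta>, \<eta>)) \<le> B"
  shows "integrable (\<nu> \<Otimes>\<^sub>M \<nu>) F"
proof -
  interpret P: finite_measure "\<nu> \<Otimes>\<^sub>M \<nu>"
    by (intro finite_measure_pair_measure finite_measure_axioms)
  show ?thesis
  proof (rule P.integrable_const_bound[where B = B])
    show "AE x in \<nu> \<Otimes>\<^sub>M \<nu>. norm (F x) \<le> B"
      using AE_torus_pair
    proof eventually_elim
      case (elim x)
      then show ?case using assms(2)[of "fst x" "snd x"] by simp
    qed
  qed (use assms in auto)
qed

text \<open>By Fubini the double integral is a number times its conjugate. This is the source of all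
  positivity in the expansion of the energy.\<close>

lemma pair_integral_mult_cnj:
  fixes \<phi> :: "complex \<times> complex \<Rightarrow> complex"
  assumes [measurable]: "\<phi> \<in> borel_measurable borel" and B: "\<And>\<zeta>. \<zeta> \<in> torus \<Longrightarrow> cmod (\<phi> \<zeta>) \<le> B"
  shows "integrable (\<nu> \<Otimes>\<^sub>M \<nu>) (\<lambda>(\<zeta>, \<eta>). \<phi> \<zeta> * cnj (\<phi> \<eta>))"
    and "(\<integral>(\<zeta>, \<eta>). \<phi> \<zeta> * cnj (\<phi> \<eta>) \<partial>(\<nu> \<Otimes>\<^sub>M \<nu>)) = of_real ((cmod (\<integral>\<zeta>. \<phi> \<zeta> \<partial>\<nu>))\<^sup>2)"
proof -
  show int: "integrable (\<nu> \<Otimes>\<^sub>M \<nu>) (\<lambda>(\<zeta>, \<eta>). \<phi> \<zeta> * cnj (\<phi> \<eta>))"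
  proof (rule integrable_pair_bounded_on_torus)
    show "(\<lambda>(\<zeta>, \<eta>). \<phi> \<zeta> * cnj (\<phi> \<eta>)) \<in> borel_measurable (\<nu> \<Otimes>\<^sub>M \<nu>)"
      by measurable
    fix \<zeta> \<eta> assume "\<zeta> \<in> torus" "\<eta> \<in> torus"
    then show "norm (case (\<zeta>, \<eta>) of (\<zeta>, \<eta>) \<Rightarrow> \<phi> \<zeta> * cnj (\<phi> \<eta>)) \<le> B * B"
      using B[of \<zeta>] B[of \<eta>] by (auto simp: norm_mult intro!: mult_mono order_trans[OF norm_ge_zero])
  qed
  have "(\<integral>(\<zeta>, \<eta>). \<phi> \<zeta> * cnj (\<phi> \<eta>) \<partial>(\<nu> \<Otimes>\<^sub>M \<nu>)) = (\<integral>\<zeta>. (\<integral>\<eta>. \<phi> \<zeta> * cnj (\<phi> \<eta>) \<partial>\<nu>) \<partial>\<nu>)"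
    using PP.integral_fst[of "\<lambda>\<zeta> \<eta>. \<phi> \<zeta> * cnj (\<phi> \<eta>)"] int by simp
  also have "\<dots> = (\<integral>\<zeta>. \<phi> \<zeta> \<partial>\<nu>) * cnj (\<integral>\<zeta>. \<phi> \<zeta> \<partial>\<nu>)"
    by simp
  finally show "(\<integral>(\<zeta>, \<eta>). \<phi> \<zeta> * cnj (\<phi> \<eta>) \<partial>(\<nu> \<Otimes>\<^sub>M \<nu>)) = of_real ((cmod (\<integral>\<zeta>. \<phi> \<zeta> \<partial>\<nu>))\<^sup>2)"
    unfolding complex_norm_square .
qed

text \<open>The product sigma-algebra is the Borel one, so the inner maps are measurable by
  continuity.\<close>

lemma borel_measurable_pair_coordinates:
  fixes \<phi> :: "complex \<Rightarrow> 'b::topological_space"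
  assumes "\<phi> \<in> borel_measurable borel"
  shows "(\<lambda>x. \<phi> (fst (fst x) * cnj (fst (snd x)))) \<in> borel_measurable (\<nu> \<Otimes>\<^sub>M \<nu>)"
    and "(\<lambda>x. \<phi> (snd (fst x) * cnj (snd (snd x)))) \<in> borel_measurable (\<nu> \<Otimes>\<^sub>M \<nu>)"
proof -
  have "sets (\<nu> \<Otimes>\<^sub>M \<nu>) = sets borel"
    using sets_pair_measure_cong[OF sets_eq sets_eq] unfolding borel_prod .
  note * = measurable_cong_sets[OF this refl]
  show "(\<lambda>x. \<phi> (fst (fst x) * cnj (fst (snd x)))) \<in> borel_measurable (\<nu> \<Otimes>\<^sub>M \<nu>)"
    "(\<lambda>x. \<phi> (snd (fst x) * cnj (snd (snd x)))) \<in> borel_measurable (\<nu> \<Otimes>\<^sub>M \<nu>)"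
    unfolding *
    by (rule measurable_compose[OF _ assms], intro borel_measurable_continuous_onI continuous_intros)+
qed

lemma pair_integral_sum_mult_cnj:
  fixes \<phi> :: "nat \<Rightarrow> nat \<Rightarrow> complex \<times> complex \<Rightarrow> complex" and c :: "nat \<Rightarrow> nat \<Rightarrow> real"
  assumes [measurable]: "\<And>k l. \<phi> k l \<in> borel_measurable borel"
    and B: "\<And>k l \<zeta>. \<zeta> \<in> torus \<Longrightarrow> cmod (\<phi> k l \<zeta>) \<le> 1"
  shows "integrable (\<nu> \<Otimes>\<^sub>M \<nu>)
      (\<lambda>(\<zeta>, \<eta>). \<Sum>k<N. \<Sum>l<N. of_real (c k l) * (\<phi> k l \<zeta> * cnj (\<phi> k l \<eta>)))" (is ?int)
    and "(\<integral>(\<zeta>, \<eta>). (\<Sum>k<N. \<Sum>l<N. of_real (c k l) * (\<phi> k l \<zeta> * cnj (\<phi> k l \<eta>))) \<partial>(\<nu> \<Otimes>\<^sub>M \<nu>))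
      = of_real (\<Sum>k<N. \<Sum>l<N. c k l * (cmod (\<integral>\<zeta>. \<phi> k l \<zeta> \<partial>\<nu>))\<^sup>2)" (is ?eq)
proof -
  have i: "integrable (\<nu> \<Otimes>\<^sub>M \<nu>) (\<lambda>x. \<phi> k l (fst x) * cnj (\<phi> k l (snd x)))"
    and e: "(\<integral>x. \<phi> k l (fst x) * cnj (\<phi> k l (snd x)) \<partial>(\<nu> \<Otimes>\<^sub>M \<nu>))
      = of_real ((cmod (\<integral>\<zeta>. \<phi> k l \<zeta> \<partial>\<nu>))\<^sup>2)" for k l
    using pair_integral_mult_cnj[of "\<phi> k l" 1] B by (auto simp: case_prod_unfold)
  show ?int
    unfolding case_prod_unfold using i by (intro Bochner_Integration.integrable_sum integrable_mult_right)
  show ?eq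
    unfolding case_prod_unfold using i e
    by (simp add: Bochner_Integration.integral_sum Bochner_Integration.integrable_sum)
qed

text \<open>The product of the real parts of the two truncated series converges boundedly to
  \<open>X\<close>, and its integral expands into nonnegative multiples of squared Fourier
  coefficients. The factor 2 is the denominator in \<open>Re_mult_Re\<close>.\<close>

lemma abel_energy_ge:
  assumes r: "0 \<le> r" "r < 1"
  defines "X \<equiv> \<lambda>(\<zeta>, \<eta>). abel_log_kernel r (fst \<zeta> * cnj (fst \<eta>)) * abel_log_kernel r (snd \<zeta> * cnj (snd \<eta>))"
  shows "integrable (\<nu> \<Otimes>\<^sub>M \<nu>) X"
    and "(\<Sum>k<M. \<Sum>l<M. log_coeff k * r ^ k * (log_coeff l * r ^ l) * (cmod (torus_moment \<nu> k l))\<^sup>2)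
      \<le> 2 * (\<integral>x. X x \<partial>(\<nu> \<Otimes>\<^sub>M \<nu>))"
proof -
  interpret P: finite_measure "\<nu> \<Otimes>\<^sub>M \<nu>"
    by (intro finite_measure_pair_measure finite_measure_axioms)
  define S where "S N x = log_poly r N (fst (fst x) * cnj (fst (snd x)))"
    for N and x :: "(complex \<times> complex) \<times> (complex \<times> complex)"
  define T where "T N x = log_poly r N (snd (fst x) * cnj (snd (snd x)))"
    for N and x :: "(complex \<times> complex) \<times> (complex \<times> complex)"
  define c where "c k l = log_coeff k * r ^ k * (log_coeff l * r ^ l)" for k l
  have c: "0 \<le> c k l" for k l using r log_coeff_bounds by (auto simp: c_def)
  have [measurable]: "S N \<in> borel_measurable (\<nu> \<Otimes>\<^sub>M \<nu>)" "T N \<in> borel_measurable (\<nu> \<Otimes>\<^sub>M \<nu>)" for N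
    unfolding S_def T_def by (intro borel_measurable_pair_coordinates borel_measurable_log_poly)+
  have [measurable]: "X \<in> borel_measurable (\<nu> \<Otimes>\<^sub>M \<nu>)"
    unfolding X_def case_prod_unfold
    by (intro borel_measurable_times borel_measurable_pair_coordinates borel_measurable_abel_log_kernel)
  have cmod1: "cmod (fst \<zeta>) = 1" "cmod (snd \<zeta>) = 1" if "\<zeta> \<in> torus" for \<zeta>
    using that by (auto simp: torus_def)
  let ?B = "1 / (1 - r)"
  have dom: "AE x in \<nu> \<Otimes>\<^sub>M \<nu>. norm (Re (S N x) * Re (T N x)) \<le> ?B * ?B" for N
    using AE_torus_pair
  proof eventually_elim
    case (elim x)
    have "\<bar>Re (S N x)\<bar> \<le> ?B" "\<bar>Re (T N x)\<bar> \<le> ?B"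
      unfolding S_def T_def using elim r
      by (auto intro!: order_trans[OF abs_Re_le_cmod norm_log_poly_le] simp: norm_mult cmod1)
    then show ?case using r by (auto simp: abs_mult intro!: mult_mono simp del: times_divide_eq_left times_divide_eq_right)
  qed
  have lim: "AE x in \<nu> \<Otimes>\<^sub>M \<nu>. (\<lambda>N. Re (S N x) * Re (T N x)) \<longlonglongrightarrow> X x"
    using AE_torus_pair
  proof eventually_elim
    case (elim x)
    then show ?case unfolding S_def T_def X_def case_prod_unfold
      using r by (intro tendsto_mult log_poly_tendsto) (auto simp: norm_mult cmod1)
  qed
  note dct = integral_dominated_convergence[where s = "\<lambda>N x. Re (S N x) * Re (T N x)" and f = X
      and w = "\<lambda>_. ?B * ?B" and M = "\<nu> \<Otimes>\<^sub>M \<nu>", OF _ _ _ lim dom]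
  show "integrable (\<nu> \<Otimes>\<^sub>M \<nu>) X"
    by (rule integrable_dominated_convergence[where s = "\<lambda>N x. Re (S N x) * Re (T N x)" and f = X
      and w = "\<lambda>_. ?B * ?B" and M = "\<nu> \<Otimes>\<^sub>M \<nu>", OF _ _ _ lim dom]) auto
  have conv: "(\<lambda>N. 2 * (\<integral>x. Re (S N x) * Re (T N x) \<partial>(\<nu> \<Otimes>\<^sub>M \<nu>)))
      \<longlonglongrightarrow> 2 * (\<integral>x. X x \<partial>(\<nu> \<Otimes>\<^sub>M \<nu>))"
    by (intro tendsto_mult tendsto_const dct) auto
  have ge: "(\<Sum>k<N. \<Sum>l<N. c k l * (cmod (torus_moment \<nu> k l))\<^sup>2)
      \<le> 2 * (\<integral>x. Re (S N x) * Re (T N x) \<partial>(\<nu> \<Otimes>\<^sub>M \<nu>))" for N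
  proof -
    \<comment> \<open>On the torus these are the characters of frequency \<open>(k, l)\<close> and
      \<open>(k, -l)\<close>. The first family diagonalizes \<open>S * T\<close>, the second
      \<open>S * cnj T\<close>.\<close>
    define \<phi> where "\<phi> = (\<lambda>k l (\<zeta>::complex \<times> complex). fst \<zeta> ^ k * snd \<zeta> ^ l)"
    define \<psi> where "\<psi> = (\<lambda>k l (\<zeta>::complex \<times> complex). fst \<zeta> ^ k * cnj (snd \<zeta>) ^ l)"
    have [measurable]: "\<phi> k l \<in> borel_measurable borel" "\<psi> k l \<in> borel_measurable borel" for k l
      unfolding \<phi>_def \<psi>_def
      by (intro borel_measurable_continuous_onI continuous_intros)+
    have 1: "S N x * T N x
        = (\<Sum>k<N. \<Sum>l<N. of_real (c k l) * (\<phi> k l (fst x) * cnj (\<phi> k l (snd x))))" for x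
      by (simp add: S_def T_def log_poly_def \<phi>_def c_def sum_product power_mult_distrib mult_ac)
    have 2: "S N x * cnj (T N x)
        = (\<Sum>k<N. \<Sum>l<N. of_real (c k l) * (\<psi> k l (fst x) * cnj (\<psi> k l (snd x))))" for x
      by (simp add: S_def T_def log_poly_def \<psi>_def c_def sum_product power_mult_distrib mult_ac)
    have b: "cmod (\<phi> k l \<zeta>) \<le> 1" "cmod (\<psi> k l \<zeta>) \<le> 1" if "\<zeta> \<in> torus" for k l \<zeta>
      using cmod1[OF that] by (auto simp: \<phi>_def \<psi>_def norm_mult norm_power)
    have i: "integrable (\<nu> \<Otimes>\<^sub>M \<nu>) (\<lambda>x. S N x * T N x)"
      "integrable (\<nu> \<Otimes>\<^sub>M \<nu>) (\<lambda>x. S N x * cnj (T N x))"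
      using pair_integral_sum_mult_cnj(1)[of \<phi> c N] pair_integral_sum_mult_cnj(1)[of \<psi> c N] b
      by (simp_all add: 1 2 case_prod_unfold)
    have "2 * (\<integral>x. Re (S N x) * Re (T N x) \<partial>(\<nu> \<Otimes>\<^sub>M \<nu>))
        = (\<integral>x. Re (S N x * T N x) + Re (S N x * cnj (T N x)) \<partial>(\<nu> \<Otimes>\<^sub>M \<nu>))"
      unfolding Re_mult_Re by simp
    also have "\<dots> = Re (\<integral>x. S N x * T N x \<partial>(\<nu> \<Otimes>\<^sub>M \<nu>)) + Re (\<integral>x. S N x * cnj (T N x) \<partial>(\<nu> \<Otimes>\<^sub>M \<nu>))"
      using i by (simp only: Bochner_Integration.integral_add integrable_Re integral_Re)
    also have "(\<integral>x. S N x * T N x \<partial>(\<nu> \<Otimes>\<^sub>M \<nu>))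
        = of_real (\<Sum>k<N. \<Sum>l<N. c k l * (cmod (\<integral>\<zeta>. \<phi> k l \<zeta> \<partial>\<nu>))\<^sup>2)"
      using pair_integral_sum_mult_cnj(2)[of \<phi> c N] b by (simp add: 1 case_prod_unfold)
    also have "(\<integral>x. S N x * cnj (T N x) \<partial>(\<nu> \<Otimes>\<^sub>M \<nu>))
        = of_real (\<Sum>k<N. \<Sum>l<N. c k l * (cmod (\<integral>\<zeta>. \<psi> k l \<zeta> \<partial>\<nu>))\<^sup>2)"
      using pair_integral_sum_mult_cnj(2)[of \<psi> c N] b by (simp add: 2 case_prod_unfold)
    finally have "2 * (\<integral>x. Re (S N x) * Re (T N x) \<partial>(\<nu> \<Otimes>\<^sub>M \<nu>))
        = (\<Sum>k<N. \<Sum>l<N. c k l * (cmod (\<integral>\<zeta>. \<phi> k l \<zeta> \<partial>\<nu>))\<^sup>2)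
        + (\<Sum>k<N. \<Sum>l<N. c k l * (cmod (\<integral>\<zeta>. \<psi> k l \<zeta> \<partial>\<nu>))\<^sup>2)"
      by (simp only: Re_complex_of_real)
    \<comment> \<open>The mixed frequencies can only increase the energy; dropping them leaves the
      coefficients that pair with holomorphic functions.\<close>
    moreover have "0 \<le> (\<Sum>k<N. \<Sum>l<N. c k l * (cmod (\<integral>\<zeta>. \<psi> k l \<zeta> \<partial>\<nu>))\<^sup>2)"
      using c by (intro sum_nonneg mult_nonneg_nonneg) auto
    moreover have "(\<integral>\<zeta>. \<phi> k l \<zeta> \<partial>\<nu>) = torus_moment \<nu> k l" for k l
      by (simp add: \<phi>_def torus_moment_def)
    ultimately show ?thesis by simp
  qed
  have "(\<Sum>k<M. \<Sum>l<M. c k l * (cmod (torus_moment \<nu> k l))\<^sup>2) \<le> 2 * (\<integral>x. X x \<partial>(\<nu> \<Otimes>\<^sub>M \<nu>))"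
  \<comment> \<open>The square of side \<open>M\<close> stays fixed while the truncation
    \<open>N\<close> tends to infinity; for \<open>N \<ge> M\<close> the larger square only adds
    nonnegative terms.\<close>
  proof (rule LIMSEQ_le_const[OF conv], intro exI allI impI)
    fix N assume "M \<le> N"
    then have "(\<Sum>k<M. \<Sum>l<M. c k l * (cmod (torus_moment \<nu> k l))\<^sup>2)
        \<le> (\<Sum>k<N. \<Sum>l<N. c k l * (cmod (torus_moment \<nu> k l))\<^sup>2)"
      using c unfolding sum.cartesian_product by (intro sum_mono2) auto
    then show "(\<Sum>k<M. \<Sum>l<M. c k l * (cmod (torus_moment \<nu> k l))\<^sup>2)
        \<le> 2 * (\<integral>x. Re (S N x) * Re (T N x) \<partial>(\<nu> \<Otimes>\<^sub>M \<nu>))"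
      using ge[of N] by simp
  qed
  then show "(\<Sum>k<M. \<Sum>l<M. log_coeff k * r ^ k * (log_coeff l * r ^ l) * (cmod (torus_moment \<nu> k l))\<^sup>2)
      \<le> 2 * (\<integral>x. X x \<partial>(\<nu> \<Otimes>\<^sub>M \<nu>))"
    by (simp add: c_def)
qed

text \<open>The kernel comparison loses a factor 4 in each variable, hence 16. The bound does not
  depend on \<open>r\<close>.\<close>

lemma abel_energy_le:
  assumes r: "0 \<le> r" "r < 1" and fin: "log_energy \<nu> < \<infinity>"
  shows "(\<integral>(\<zeta>, \<eta>). abel_log_kernel r (fst \<zeta> * cnj (fst \<eta>)) * abel_log_kernel r (snd \<zeta> * cnj (snd \<eta>))
      \<partial>(\<nu> \<Otimes>\<^sub>M \<nu>)) \<le> 16 * enn2real (log_energy \<nu>)"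
proof -
  define X where "X = (\<lambda>(\<zeta>, \<eta>). abel_log_kernel r (fst \<zeta> * cnj (fst \<eta>)) * abel_log_kernel r (snd \<zeta> * cnj (snd \<eta>)))"
  have [measurable]: "X \<in> borel_measurable (\<nu> \<Otimes>\<^sub>M \<nu>)"
    unfolding X_def case_prod_unfold
    by (intro borel_measurable_times borel_measurable_pair_coordinates borel_measurable_abel_log_kernel)
  have int: "integrable (\<nu> \<Otimes>\<^sub>M \<nu>) X"
    unfolding X_def by (rule abel_energy_ge(1)[OF r])
  have "AE x in \<nu> \<Otimes>\<^sub>M \<nu>. 0 \<le> X x / 16"
    using AE_torus_pair
    by eventually_elim
       (use r in \<open>auto simp: X_def torus_def norm_mult intro!: mult_nonneg_nonneg abel_log_kernel_nonneg\<close>)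
  then have "ennreal (\<integral>x. X x / 16 \<partial>(\<nu> \<Otimes>\<^sub>M \<nu>)) = (\<integral>\<^sup>+x. ennreal (X x / 16) \<partial>(\<nu> \<Otimes>\<^sub>M \<nu>))"
    using int by (intro nn_integral_eq_integral[symmetric]) auto
  also have "\<dots> = (\<integral>\<^sup>+\<zeta>. \<integral>\<^sup>+\<eta>. ennreal (X (\<zeta>, \<eta>) / 16) \<partial>\<nu> \<partial>\<nu>)"
    by (subst nn_integral_fst[symmetric]) auto
  also have "\<dots> \<le> log_energy \<nu>"
    unfolding log_energy_def
  \<comment> \<open>The energy is an iterated integral, so monotonicity is applied to the outer and
    then to the inner integral.\<close>
  proof (rule nn_integral_mono_AE)
    show "AE \<zeta> in \<nu>. (\<integral>\<^sup>+\<eta>. ennreal (X (\<zeta>, \<eta>) / 16) \<partial>\<nu>)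
        \<le> (\<integral>\<^sup>+\<eta>. log_kernel (fst \<zeta>) (fst \<eta>) * log_kernel (snd \<zeta>) (snd \<eta>) \<partial>\<nu>)"
      using AE_torus
    proof eventually_elim
      fix \<zeta> assume \<zeta>: "\<zeta> \<in> torus"
      show "(\<integral>\<^sup>+\<eta>. ennreal (X (\<zeta>, \<eta>) / 16) \<partial>\<nu>)
        \<le> (\<integral>\<^sup>+\<eta>. log_kernel (fst \<zeta>) (fst \<eta>) * log_kernel (snd \<zeta>) (snd \<eta>) \<partial>\<nu>)"
      proof (rule nn_integral_mono_AE)
        show "AE \<eta> in \<nu>. ennreal (X (\<zeta>, \<eta>) / 16)
            \<le> log_kernel (fst \<zeta>) (fst \<eta>) * log_kernel (snd \<zeta>) (snd \<eta>)"
          using AE_torus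
        proof eventually_elim
          fix \<eta> assume \<eta>: "\<eta> \<in> torus"
          let ?a = "abel_log_kernel r (fst \<zeta> * cnj (fst \<eta>)) / 4"
          let ?b = "abel_log_kernel r (snd \<zeta> * cnj (snd \<eta>)) / 4"
          have "0 \<le> ?a" "0 \<le> ?b"
            using \<zeta> \<eta> r by (auto simp: torus_def norm_mult intro!: abel_log_kernel_nonneg)
          then have "ennreal (X (\<zeta>, \<eta>) / 16) = ennreal ?a * ennreal ?b"
            by (subst ennreal_mult[symmetric]) (auto simp: X_def)
          also have "\<dots> \<le> log_kernel (fst \<zeta>) (fst \<eta>) * log_kernel (snd \<zeta>) (snd \<eta>)"
            using \<zeta> \<eta> r by (intro mult_mono abel_log_kernel_le_log_kernel) (auto simp: torus_def)
          finally show "ennreal (X (\<zeta>, \<eta>) / 16)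
            \<le> log_kernel (fst \<zeta>) (fst \<eta>) * log_kernel (snd \<zeta>) (snd \<eta>)" .
        qed
      qed
    qed
  qed
  also have "\<dots> = ennreal (enn2real (log_energy \<nu>))"
    using fin by simp
  finally have "(\<integral>x. X x / 16 \<partial>(\<nu> \<Otimes>\<^sub>M \<nu>)) \<le> enn2real (log_energy \<nu>)"
    by (simp del: ennreal_enn2real)
  then show ?thesis by (simp add: X_def)
qed

text \<open>The lower and upper estimates of the Abel energy combine to the constant
  \<open>2 * 16\<close> for every \<open>r < 1\<close>. The finite sum is a polynomial in
  \<open>r\<close>, so \<open>r\<close> may tend to 1, and
  \<open>1 / (n + 1) \<le> log_coeff n\<close> gives the weights.\<close>

lemma moment_sum_le_log_energy:
  assumes fin: "log_energy \<nu> < \<infinity>"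
  shows "(\<Sum>(k, l)\<in>{..<M} \<times> {..<M}. (cmod (torus_moment \<nu> k l))\<^sup>2 / (real (k + 1) * real (l + 1)))
      \<le> 32 * enn2real (log_energy \<nu>)"
proof -
  let ?Q = "\<lambda>r. \<Sum>k<M. \<Sum>l<M. log_coeff k * r ^ k * (log_coeff l * r ^ l) * (cmod (torus_moment \<nu> k l))\<^sup>2"
  have "(\<Sum>(k, l)\<in>{..<M} \<times> {..<M}. (cmod (torus_moment \<nu> k l))\<^sup>2 / (real (k + 1) * real (l + 1)))
      \<le> ?Q 1"
    unfolding sum.cartesian_product[symmetric]
  proof (intro sum_mono)
    fix k l
    have "(1 / real (k + 1) * (1 / real (l + 1))) * (cmod (torus_moment \<nu> k l))\<^sup>2
        \<le> (log_coeff k * log_coeff l) * (cmod (torus_moment \<nu> k l))\<^sup>2"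
      using log_coeff_bounds by (intro mult_right_mono mult_mono) auto
    then show "(cmod (torus_moment \<nu> k l))\<^sup>2 / (real (k + 1) * real (l + 1))
        \<le> log_coeff k * 1 ^ k * (log_coeff l * 1 ^ l) * (cmod (torus_moment \<nu> k l))\<^sup>2"
      by simp
  qed
  also have "?Q 1 \<le> 32 * enn2real (log_energy \<nu>)"
  proof (rule tendsto_upperbound)
    show "(?Q \<longlongrightarrow> ?Q 1) (at_left 1)"
      by (intro tendsto_intros)
    have "eventually (\<lambda>r::real. r \<in> {0<..<1}) (at_left 1)"
      by (rule eventually_at_leftI[of 0]) auto
    then show "eventually (\<lambda>r. ?Q r \<le> 32 * enn2real (log_energy \<nu>)) (at_left 1)"
    proof eventually_elim
      case (elim r)
      then show ?case
        using abel_energy_ge(2)[of r M] abel_energy_le[OF _ _ fin, of r] by simp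
    qed
  qed auto
  finally show ?thesis .
qed

end

section \<open>Radial dilations and bounded functionals on the Dirichlet space\<close>

text \<open>The cut-off to the torus makes the dilation Borel measurable, since \<open>f\<close> is arbitrary outside
  the bidisk.\<close>

definition torus_dilation ::
  "(complex \<times> complex \<Rightarrow> complex) \<Rightarrow> real \<Rightarrow> complex \<times> complex \<Rightarrow> complex" where
  "torus_dilation f r \<zeta> = (if \<zeta> \<in> torus then f (of_real r * fst \<zeta>, of_real r * snd \<zeta>) else 0)"

text \<open>Squares are cofinal among the finite index sets. Unordered double sums thereby become
  limits of sequences, as dominated convergence requires.\<close>

lemma filterlim_squares_finite_subsets:
  "filterlim (\<lambda>N. {..<N} \<times> {..<N}) (finite_subsets_at_top (UNIV :: (nat \<times> nat) set)) sequentially"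
  unfolding filterlim_finite_subsets_at_top
proof (intro allI impI)
  fix A :: "(nat \<times> nat) set" assume A: "finite A \<and> A \<subseteq> UNIV"
  then have "finite (fst ` A \<union> snd ` A)" by simp
  then obtain m where m: "\<forall>i\<in>fst ` A \<union> snd ` A. i < m"
    using finite_nat_set_iff_bounded by blast
  show "\<forall>\<^sub>F N in sequentially. finite ({..<N} \<times> {..<N}) \<and> A \<subseteq> {..<N} \<times> {..<N} \<and> {..<N} \<times> {..<N} \<subseteq> UNIV"
    using eventually_ge_at_top[of m]
  proof eventually_elim
    case (elim N)
    have "fst x < N \<and> snd x < N" if "x \<in> A" for x
    proof
      show "fst x < N" using bspec[OF m, of "fst x"] that elim by simp
      show "snd x < N" using bspec[OF m, of "snd x"] that elim by simp
    qed
    then show ?case by (auto simp: mem_Times_iff)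
  qed
qed

lemma torus_dilation_partial_sums:
  assumes a: "has_bidisk_expansion g a" and r: "0 \<le> r" "r < 1"
  defines "p \<equiv> \<lambda>N \<zeta>. \<Sum>(k, l)\<in>{..<N} \<times> {..<N}. a k l * of_real (r ^ k * r ^ l) * (fst \<zeta> ^ k * snd \<zeta> ^ l)"
  shows "\<zeta> \<in> torus \<Longrightarrow> (\<lambda>N. p N \<zeta>) \<longlonglongrightarrow> torus_dilation g r \<zeta>"
    and "\<exists>B. \<forall>\<zeta>\<in>torus. \<forall>N. cmod (p N \<zeta>) \<le> B"
proof -
  show "(\<lambda>N. p N \<zeta>) \<longlonglongrightarrow> torus_dilation g r \<zeta>" if "\<zeta> \<in> torus"
  proof -
    have "(of_real r * fst \<zeta>, of_real r * snd \<zeta>) \<in> bidisk"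
      using that r by (auto simp: torus_def bidisk_def norm_mult)
    then have "((\<lambda>(k, l). a k l * (of_real r * fst \<zeta>) ^ k * (of_real r * snd \<zeta>) ^ l) has_sum
        torus_dilation g r \<zeta>) UNIV"
      using a that by (auto simp: has_bidisk_expansion_def torus_dilation_def)
    from filterlim_compose[OF this[unfolded has_sum_def] filterlim_squares_finite_subsets]
    show ?thesis
      by (simp add: p_def power_mult_distrib mult_ac)
  qed
  \<comment> \<open>Absolute convergence at the single point \<open>(r, r)\<close> gives a majorant
    \<open>q\<close> valid on the whole torus.\<close>
  have rb: "(of_real r, of_real r) \<in> bidisk"
    using r by (auto simp: bidisk_def)
  define q where "q = (\<lambda>(k, l). cmod (a k l * of_real r ^ k * of_real r ^ l))"
  have "(\<lambda>(k, l). a k l * of_real r ^ k * of_real r ^ l) summable_on UNIV"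
    using bspec[OF a[unfolded has_bidisk_expansion_def] rb] by (auto simp: summable_on_def)
  then have q: "q summable_on UNIV"
    by (simp add: summable_on_iff_abs_summable_on_complex q_def case_prod_unfold)
  show "\<exists>B. \<forall>\<zeta>\<in>torus. \<forall>N. cmod (p N \<zeta>) \<le> B"
  proof (intro exI ballI allI)
    fix \<zeta> N assume \<zeta>: "\<zeta> \<in> torus"
    have "cmod (p N \<zeta>) \<le> sum q ({..<N} \<times> {..<N})"
      unfolding p_def
    proof (rule order_trans[OF norm_sum sum_mono])
      fix x :: "nat \<times> nat"
      show "cmod (case x of (k, l) \<Rightarrow> a k l * of_real (r ^ k * r ^ l) * (fst \<zeta> ^ k * snd \<zeta> ^ l)) \<le> q x"
        using \<zeta> by (cases x) (auto simp: q_def norm_mult norm_power torus_def)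
    qed
    also have "\<dots> \<le> infsum q UNIV"
      using q by (intro finite_sum_le_infsum) (auto simp: q_def)
    finally show "cmod (p N \<zeta>) \<le> infsum q UNIV" .
  qed
qed

lemma borel_measurable_torus_dilation:
  assumes a: "has_bidisk_expansion g a" and r: "0 \<le> r" "r < 1"
  shows "torus_dilation g r \<in> borel_measurable borel"
proof (rule borel_measurable_LIMSEQ_metric)
  let ?p = "\<lambda>N \<zeta>. \<Sum>(k, l)\<in>{..<N} \<times> {..<N}. a k l * of_real (r ^ k * r ^ l) * (fst \<zeta> ^ k * snd \<zeta> ^ l)"
  have [measurable]: "?p N \<in> borel_measurable borel" for N
    unfolding case_prod_unfold by (intro borel_measurable_continuous_onI continuous_intros)
  show "(\<lambda>\<zeta>. if \<zeta> \<in> torus then ?p N \<zeta> else 0) \<in> borel_measurable borel" for N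
    by measurable
  show "(\<lambda>N. if \<zeta> \<in> torus then ?p N \<zeta> else 0) \<longlonglongrightarrow> torus_dilation g r \<zeta>" for \<zeta>
    using torus_dilation_partial_sums(1)[OF a r, of \<zeta>]
    by (cases "\<zeta> \<in> torus") (auto simp: torus_dilation_def)
qed

lemma dirichlet_norm_eq:
  "has_bidisk_expansion g a \<Longrightarrow>
    dirichlet_norm g = sqrt (\<Sum>\<^sub>\<infinity>(k, l). real (k + 1) * real (l + 1) * (cmod (a k l))\<^sup>2)"
  unfolding dirichlet_norm_def by (drule bidisk_coeff_eq) simp

context torus_measure
begin

text \<open>Cauchy-Schwarz pairs the weighted coefficients of \<open>g\<close> with the inversely
  weighted Fourier coefficients of \<open>\<nu>\<close>, first for partial sums and then in the
  limit.\<close>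

lemma norm_integral_dilation_le:
  assumes g: "g \<in> dirichlet_space" and r: "0 \<le> r" "r < 1" and fin: "log_energy \<nu> < \<infinity>"
  shows "cmod (\<integral>\<zeta>. torus_dilation g r \<zeta> \<partial>\<nu>) \<le> sqrt (32 * enn2real (log_energy \<nu>)) * dirichlet_norm g"
proof -
  from g obtain a where a: "has_bidisk_expansion g a"
    and sa: "(\<lambda>(k, l). real (k + 1) * real (l + 1) * (cmod (a k l))\<^sup>2) summable_on UNIV"
    unfolding dirichlet_space_def by blast
  define p where "p = (\<lambda>N \<zeta>. \<Sum>(k, l)\<in>{..<N} \<times> {..<N}. a k l * of_real (r ^ k * r ^ l) * (fst \<zeta> ^ k * snd \<zeta> ^ l))"
  obtain B where B: "\<And>\<zeta> N. \<zeta> \<in> torus \<Longrightarrow> cmod (p N \<zeta>) \<le> B"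
    using torus_dilation_partial_sums(2)[OF a r] unfolding p_def by blast
  have [measurable]: "p N \<in> borel_measurable borel" for N
    unfolding p_def case_prod_unfold by (intro borel_measurable_continuous_onI continuous_intros)
  have lim: "AE \<zeta> in \<nu>. (\<lambda>N. p N \<zeta>) \<longlonglongrightarrow> torus_dilation g r \<zeta>"
    using AE_torus by eventually_elim (use torus_dilation_partial_sums(1)[OF a r] in \<open>auto simp: p_def\<close>)
  have dom: "AE \<zeta> in \<nu>. norm (p N \<zeta>) \<le> B" for N
    using AE_torus by eventually_elim (use B in auto)
  have conv: "(\<lambda>N. \<integral>\<zeta>. p N \<zeta> \<partial>\<nu>) \<longlonglongrightarrow> (\<integral>\<zeta>. torus_dilation g r \<zeta> \<partial>\<nu>)"
    using borel_measurable_torus_dilation[OF a r]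
    by (intro integral_dominated_convergence[OF _ _ _ lim dom])
       (auto simp: measurable_cong_sets[OF sets_eq refl])
  let ?M = "torus_moment \<nu>" and ?W = "\<lambda>k l. real (k + 1) * real (l + 1)"
  have bound: "cmod (\<integral>\<zeta>. p N \<zeta> \<partial>\<nu>) \<le> sqrt (32 * enn2real (log_energy \<nu>)) * dirichlet_norm g" for N
  proof -
    let ?I = "{..<N} \<times> {..<N}"
    have int: "integrable \<nu> (\<lambda>\<zeta>. fst \<zeta> ^ k * snd \<zeta> ^ l)" for k l
      by (rule integrable_bounded_on_torus[where B = 1])
         (auto simp: torus_def norm_mult norm_power
            intro!: borel_measurable_continuous_onI continuous_intros)
    define u where "u x = sqrt (?W (fst x) (snd x)) * cmod (a (fst x) (snd x))" for x
    define v where "v x = cmod (?M (fst x) (snd x)) / sqrt (?W (fst x) (snd x))" for x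
    have "(\<integral>\<zeta>. p N \<zeta> \<partial>\<nu>) = (\<Sum>x\<in>?I. a (fst x) (snd x) * of_real (r ^ fst x * r ^ snd x) * ?M (fst x) (snd x))"
      unfolding p_def case_prod_unfold torus_moment_def using int
      by (simp add: Bochner_Integration.integral_sum)
    also have "cmod \<dots> \<le> (\<Sum>x\<in>?I. u x * v x)"
    proof (rule order_trans[OF norm_sum sum_mono])
      fix x
      \<comment> \<open>Estimating the powers of \<open>r\<close> by 1 makes the final bound uniform
        in \<open>r\<close>.\<close>
      have "cmod (a (fst x) (snd x)) * (r ^ fst x * r ^ snd x) * cmod (?M (fst x) (snd x))
          \<le> cmod (a (fst x) (snd x)) * (1 * 1) * cmod (?M (fst x) (snd x))"
        using r by (intro mult_mono mult_left_mono mult_right_mono power_le_one) auto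
      then show "cmod (a (fst x) (snd x) * of_real (r ^ fst x * r ^ snd x) * ?M (fst x) (snd x)) \<le> u x * v x"
        using r by (simp add: norm_mult norm_power u_def v_def)
    qed
    also have "\<dots> \<le> sqrt ((\<Sum>x\<in>?I. (u x)\<^sup>2) * (\<Sum>x\<in>?I. (v x)\<^sup>2))"
      by (intro real_le_rsqrt Cauchy_Schwarz_ineq_sum)
    also have "\<dots> = sqrt (\<Sum>x\<in>?I. (v x)\<^sup>2) * sqrt (\<Sum>x\<in>?I. (u x)\<^sup>2)"
      by (simp add: real_sqrt_mult)
    also have "\<dots> \<le> sqrt (32 * enn2real (log_energy \<nu>)) * dirichlet_norm g"
    proof (intro mult_mono)
      have "(v x)\<^sup>2 = (case x of (k, l) \<Rightarrow> (cmod (?M k l))\<^sup>2 / ?W k l)" for x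
        by (simp add: v_def power_divide case_prod_unfold)
      then show "sqrt (\<Sum>x\<in>?I. (v x)\<^sup>2) \<le> sqrt (32 * enn2real (log_energy \<nu>))"
        using moment_sum_le_log_energy[OF fin, of N] by simp
      have u: "(u x)\<^sup>2 = (case x of (k, l) \<Rightarrow> ?W k l * (cmod (a k l))\<^sup>2)" for x
        by (simp add: u_def power_mult_distrib case_prod_unfold)
      show "sqrt (\<Sum>x\<in>?I. (u x)\<^sup>2) \<le> dirichlet_norm g"
        unfolding dirichlet_norm_eq[OF a] u
        using sa by (intro real_sqrt_le_mono finite_sum_le_infsum) auto
    qed (auto intro!: real_sqrt_ge_zero sum_nonneg)
    finally show ?thesis .
  qed
  show ?thesis
    by (rule LIMSEQ_le_const2[OF tendsto_norm[OF conv]]) (use bound in auto)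
qed

end

section \<open>Polynomial multiples of \<open>f\<close>\<close>

text \<open>Monomials have modulus at most 1 on the closed bidisk, so the sum of the moduli of the
  scalars serves as \<open>C\<close>. Being independent of \<open>r\<close> and
  \<open>\<zeta>\<close>, it carries boundedness and convergence to 0 over from \<open>f\<close> to
  \<open>h\<close>.\<close>

lemma span_monomial_multiples_bound:
  assumes "h \<in> complex_span {\<lambda>z. fst z ^ k * snd z ^ l * f z | k l. True}"
  obtains C where "\<And>r \<zeta>. 0 \<le> r \<Longrightarrow> r < 1 \<Longrightarrow> cmod (torus_dilation h r \<zeta>) \<le> C * cmod (torus_dilation f r \<zeta>)"
proof -
  from assms obtain T c where h: "h = (\<lambda>z. \<Sum>q\<in>T. c q * q z)" and "finite T"
    and T: "T \<subseteq> {\<lambda>z. fst z ^ k * snd z ^ l * f z | k l. True}"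
    unfolding complex_span_def by blast
  have "cmod (torus_dilation h r \<zeta>) \<le> (\<Sum>q\<in>T. cmod (c q)) * cmod (torus_dilation f r \<zeta>)"
    if r: "0 \<le> r" "r < 1" for r \<zeta>
  proof (cases "\<zeta> \<in> torus")
    case True
    let ?w = "(of_real r * fst \<zeta>, of_real r * snd \<zeta>)"
    have "cmod (\<Sum>q\<in>T. c q * q ?w) \<le> (\<Sum>q\<in>T. cmod (c q) * cmod (f ?w))"
    proof (rule order_trans[OF norm_sum sum_mono])
      fix q assume "q \<in> T"
      then obtain k l where q: "q = (\<lambda>z. fst z ^ k * snd z ^ l * f z)" using T by blast
      have "r ^ k * r ^ l * cmod (f ?w) \<le> 1 * 1 * cmod (f ?w)"
        using r by (intro mult_mono mult_right_mono power_le_one) auto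
      moreover have "cmod (q ?w) = r ^ k * r ^ l * cmod (f ?w)"
        using r True by (simp add: q norm_mult norm_power torus_def mem_Times_iff)
      ultimately have "cmod (q ?w) \<le> cmod (f ?w)" by simp
      then show "cmod (c q * q ?w) \<le> cmod (c q) * cmod (f ?w)"
        by (simp add: norm_mult mult_left_mono)
    qed
    then show ?thesis
      using True by (simp add: torus_dilation_def h sum_distrib_right)
  qed (simp add: torus_dilation_def)
  then show ?thesis using that by blast
qed

text \<open>\<open>dirichlet_norm\<close> is meaningful only for functions with an expansion, so
  membership is secured before the functionals are applied to \<open>h - 1\<close>.\<close>

lemma span_monomial_multiples_in_dirichlet_space:
  assumes "f \<in> dirichlet_space" "h \<in> complex_span {\<lambda>z. fst z ^ k * snd z ^ l * f z | k l. True}"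
  shows "h \<in> dirichlet_space"
proof -
  from assms(2) obtain T c where h: "h = (\<lambda>z. \<Sum>q\<in>T. c q * q z)" and "finite T"
    and T: "T \<subseteq> {\<lambda>z. fst z ^ k * snd z ^ l * f z | k l. True}"
    unfolding complex_span_def by blast
  show ?thesis
    unfolding h using \<open>finite T\<close>
  proof (rule dirichlet_space_sum)
    fix q assume "q \<in> T"
    then obtain k l where q: "q = (\<lambda>z. fst z ^ k * snd z ^ l * f z)" using T by blast
    show "(\<lambda>z. c q * q z) \<in> dirichlet_space"
      unfolding q by (intro dirichlet_space_cmult dirichlet_space_monomial_mult assms)
  qed
qed

section \<open>Restriction of the measure\<close>

text \<open>A finite-energy measure on the zero set is cut down to a set where the radial dilations of
  \<open>f\<close> are uniformly bounded along a sequence of radii. Dominated convergence then takes the place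
  of a capacitary maximal inequality.\<close>

lemma finite_energy_measure_bounded_dilations:
  assumes f: "f \<in> dirichlet_space" and cap: "positive_log_capacity (radial_zero_set f)"
    and \<rho>: "\<And>n. 0 \<le> \<rho> n" "\<And>n. \<rho> n < 1" "filterlim \<rho> (at_left 1) sequentially"
  obtains \<nu> m where "torus_measure \<nu>" "log_energy \<nu> < \<infinity>" "0 < measure \<nu> UNIV"
    "AE \<zeta> in \<nu>. \<forall>n. cmod (torus_dilation f (\<rho> n) \<zeta>) \<le> m"
    "AE \<zeta> in \<nu>. (\<lambda>n. torus_dilation f (\<rho> n) \<zeta>) \<longlonglongrightarrow> 0"
proof -
  define E where "E = radial_zero_set f"
  from cap obtain \<mu> where "prob_space \<mu>" and sets: "sets \<mu> = sets borel"
    and E1: "emeasure \<mu> E = 1" and fin: "log_energy \<mu> < \<infinity>"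
    unfolding positive_log_capacity_def E_def by blast
  interpret prob_space \<mu> by fact
  note [measurable_cong] = sets
  have [simp]: "space \<mu> = UNIV" using sets_eq_imp_space_eq[OF sets] by simp
  \<comment> \<open>Sets that are not measurable have \<open>emeasure\<close> 0 by convention, so
    mass 1 forces measurability.\<close>
  have [measurable]: "E \<in> sets \<mu>"
    using E1 emeasure_notin_sets by fastforce
  obtain a where a: "has_bidisk_expansion f a" using f unfolding dirichlet_space_def by blast
  have [measurable]: "torus_dilation f (\<rho> n) \<in> borel_measurable borel" for n
    using borel_measurable_torus_dilation[OF a \<rho>(1,2)] .
  have lim: "(\<lambda>n. torus_dilation f (\<rho> n) \<zeta>) \<longlonglongrightarrow> 0" and tor: "\<zeta> \<in> torus" if "\<zeta> \<in> E" for \<zeta>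
    using that filterlim_compose[OF _ \<rho>(3), of "\<lambda>r. f (of_real r * fst \<zeta>, of_real r * snd \<zeta>)"]
    by (auto simp: E_def radial_zero_set_def torus_dilation_def)
  define A where "A m = {\<zeta> \<in> E. \<forall>n. cmod (torus_dilation f (\<rho> n) \<zeta>) \<le> real m}" for m :: nat
  have "A m = E \<inter> {\<zeta> \<in> space \<mu>. \<forall>n. cmod (torus_dilation f (\<rho> n) \<zeta>) \<le> real m}" for m
    by (auto simp: A_def)
  also have "\<dots> m \<in> sets \<mu>" for m
    by measurable
  finally have [measurable]: "A m \<in> sets \<mu>" for m .
  \<comment> \<open>Convergent sequences are bounded, so the sets \<open>A m\<close> exhaust
    \<open>E\<close>; by countable subadditivity one of them is not null.\<close>
  have "E \<subseteq> (\<Union>m. A m)"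
  proof
    fix \<zeta> assume "\<zeta> \<in> E"
    then have "Bseq (\<lambda>n. torus_dilation f (\<rho> n) \<zeta>)"
      using lim convergentI convergent_imp_Bseq by blast
    then obtain K where K: "\<And>n. cmod (torus_dilation f (\<rho> n) \<zeta>) \<le> K"
      by (auto simp: Bseq_def)
    obtain m where "K \<le> real m" using real_arch_simple by blast
    then have "\<zeta> \<in> A m" using K \<open>\<zeta> \<in> E\<close> by (auto simp: A_def intro: order_trans)
    then show "\<zeta> \<in> (\<Union>m. A m)" by blast
  qed
  then have "emeasure \<mu> E \<le> emeasure \<mu> (\<Union>m. A m)"
    by (intro emeasure_mono) auto
  then have "emeasure \<mu> (\<Union>m. A m) \<noteq> 0" using E1 by auto
  then obtain m where m: "emeasure \<mu> (A m) \<noteq> 0"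
    using emeasure_UN_eq_0[of \<mu> A] by fastforce
  \<comment> \<open>A density keeps the Borel sigma-algebra of the full space, which
    \<open>torus_measure\<close> asks for.\<close>
  define \<nu> where "\<nu> = density \<mu> (indicator (A m))"
  have [simp]: "sets \<nu> = sets \<mu>" "space \<nu> = UNIV" by (simp_all add: \<nu>_def)
  have em: "emeasure \<nu> X = emeasure \<mu> (A m \<inter> X)" if "X \<in> sets \<mu>" for X
  proof -
    have "emeasure \<nu> X = (\<integral>\<^sup>+\<zeta>. indicator (A m) \<zeta> * indicator X \<zeta> \<partial>\<mu>)"
      using that unfolding \<nu>_def by (intro emeasure_density) auto
    also have "\<dots> = (\<integral>\<^sup>+\<zeta>. indicator (A m \<inter> X) \<zeta> \<partial>\<mu>)"
      by (simp only: indicator_inter_arith)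
    finally show ?thesis using that by simp
  qed
  have AE_A: "AE \<zeta> in \<nu>. \<zeta> \<in> A m"
    unfolding \<nu>_def by (subst AE_density) (auto simp: indicator_def)
  \<comment> \<open>Integrals of nonnegative functions decrease with the measure; applied to both
    integrals, this shows that restriction does not increase the energy.\<close>
  have "\<nu> \<le> \<mu>"
    unfolding le_measure_iff
  proof (simp add: le_fun_def, intro allI)
    fix X show "emeasure \<nu> X \<le> emeasure \<mu> X"
      by (cases "X \<in> sets \<mu>") (auto simp: em emeasure_notin_sets intro: emeasure_mono)
  qed
  then have le: "nn_integral \<nu> F \<le> nn_integral \<mu> F" for F
    by (intro nn_integral_mono_measure) auto
  have "log_energy \<nu> \<le> log_energy \<mu>"
    unfolding log_energy_def by (rule order_trans[OF nn_integral_mono le]) (rule le)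
  moreover have fm: "finite_measure \<nu>"
    by (rule finite_measureI) (use em[of UNIV] in auto)
  then have "torus_measure \<nu>"
    by (auto simp: torus_measure_def torus_measure_axioms_def sets A_def tor
        intro: eventually_mono[OF AE_A])
  moreover have "0 < measure \<nu> UNIV"
    using em[of UNIV] m finite_measure.emeasure_eq_measure[OF fm, of UNIV]
    by (auto simp: zero_less_measure_iff)
  moreover have "AE \<zeta> in \<nu>. \<forall>n. cmod (torus_dilation f (\<rho> n) \<zeta>) \<le> real m"
    using AE_A by eventually_elim (auto simp: A_def)
  moreover have "AE \<zeta> in \<nu>. (\<lambda>n. torus_dilation f (\<rho> n) \<zeta>) \<longlonglongrightarrow> 0"
    using AE_A by eventually_elim (auto simp: A_def lim)
  ultimately show ?thesis
    using that fin by (meson le_less_trans)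
qed

section \<open>Failure of cyclicity\<close>

theorem proposition4p2:
  fixes f :: "complex \<times> complex \<Rightarrow> complex"
  assumes "f \<in> dirichlet_space"
    and "positive_log_capacity (radial_zero_set f)"
  shows "\<not> dirichlet_cyclic f"
proof
  assume cyc: "dirichlet_cyclic f"
  \<comment> \<open>Any sequence in \<open>[0, 1)\<close> increasing to 1 would do; the shift by 2
    makes it start at \<open>1 / 2\<close>.\<close>
  define \<rho> where "\<rho> n = 1 - 1 / real (n + 2)" for n
  have \<rho>: "0 \<le> \<rho> n" "\<rho> n < 1" for n by (auto simp: \<rho>_def field_simps)
  have "\<rho> \<longlonglongrightarrow> 1 - 0"
    unfolding \<rho>_def by (intro tendsto_diff tendsto_const LIMSEQ_ignore_initial_segment[OF lim_1_over_n])
  then have \<rho>_lim: "filterlim \<rho> (at_left 1) sequentially"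
    using \<rho>(2) by (auto simp: filterlim_at less_imp_neq)
  obtain \<nu> m where "torus_measure \<nu>" and fin: "log_energy \<nu> < \<infinity>" and pos: "0 < measure \<nu> UNIV"
    and bdd: "AE \<zeta> in \<nu>. \<forall>n. cmod (torus_dilation f (\<rho> n) \<zeta>) \<le> m"
    and lim: "AE \<zeta> in \<nu>. (\<lambda>n. torus_dilation f (\<rho> n) \<zeta>) \<longlonglongrightarrow> 0"
    by (rule finite_energy_measure_bounded_dilations[OF assms \<rho> \<rho>_lim])
  interpret torus_measure \<nu> by fact
  define B where "B = sqrt (32 * enn2real (log_energy \<nu>))"
  have B: "0 \<le> B" by (simp add: B_def)
  \<comment> \<open>Chosen so that \<open>B * \<epsilon>\<close> is less than the total mass; the
    added 1 covers \<open>B = 0\<close>.\<close>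
  define \<epsilon> where "\<epsilon> = measure \<nu> UNIV / (B + 1)"
  have \<epsilon>: "0 < \<epsilon>" using pos B by (simp add: \<epsilon>_def)
  have "(\<lambda>z. 1) \<in> dirichlet_closure (complex_span {\<lambda>z. fst z ^ k * snd z ^ l * f z | k l. True})"
    using cyc one_in_dirichlet_space by (simp add: dirichlet_cyclic_def)
  with \<epsilon> obtain h where h: "h \<in> complex_span {\<lambda>z. fst z ^ k * snd z ^ l * f z | k l. True}"
    and close: "dirichlet_norm (\<lambda>z. h z - 1) < \<epsilon>"
    unfolding dirichlet_closure_def by auto
  have hD: "h \<in> dirichlet_space"
    using span_monomial_multiples_in_dirichlet_space[OF assms(1) h] .
  have gD: "(\<lambda>z. h z - 1) \<in> dirichlet_space"
    using dirichlet_space_add[OF hD dirichlet_space_cmult[OF one_in_dirichlet_space, of "-1"]] by simp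
  have meas: "torus_dilation q (\<rho> n) \<in> borel_measurable \<nu>" if "q \<in> dirichlet_space" for q n
    using that borel_measurable_torus_dilation[OF _ \<rho>, of q _ n]
    unfolding dirichlet_space_def measurable_cong_sets[OF sets_eq refl] by blast
  note [measurable] = meas[OF hD] meas[OF gD]
  obtain C where C: "\<And>r \<zeta>. 0 \<le> r \<Longrightarrow> r < 1 \<Longrightarrow> cmod (torus_dilation h r \<zeta>) \<le> C * cmod (torus_dilation f r \<zeta>)"
    using span_monomial_multiples_bound[OF h] by blast
  have hbdd: "AE \<zeta> in \<nu>. norm (torus_dilation h (\<rho> n) \<zeta>) \<le> \<bar>C\<bar> * m" for n
    using bdd
  proof eventually_elim
    case (elim \<zeta>)
    \<comment> \<open>The sign of the obtained \<open>C\<close> is unknown, hence the absolute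
      value.\<close>
    have "C * cmod (torus_dilation f (\<rho> n) \<zeta>) \<le> \<bar>C\<bar> * m"
      using elim by (intro mult_mono) auto
    then show ?case using C[OF \<rho>, of n \<zeta>] by simp
  qed
  have hlim: "AE \<zeta> in \<nu>. (\<lambda>n. torus_dilation h (\<rho> n) \<zeta>) \<longlonglongrightarrow> 0"
    using lim
  proof eventually_elim
    case (elim \<zeta>)
    have "(\<lambda>n. C * cmod (torus_dilation f (\<rho> n) \<zeta>)) \<longlonglongrightarrow> 0"
      by (intro tendsto_mult_right_zero tendsto_norm_zero elim)
    then show ?case
      by (rule Lim_null_comparison[OF always_eventually, rotated]) (use C[OF \<rho>] in blast)
  qed
  have conv: "(\<lambda>n. \<integral>\<zeta>. torus_dilation h (\<rho> n) \<zeta> \<partial>\<nu>) \<longlonglongrightarrow> (\<integral>\<zeta>. 0 \<partial>\<nu>)"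
    by (rule integral_dominated_convergence[OF _ _ _ hlim hbdd]) auto
  have eq: "(\<integral>\<zeta>. torus_dilation (\<lambda>z. h z - 1) (\<rho> n) \<zeta> \<partial>\<nu>)
      = (\<integral>\<zeta>. torus_dilation h (\<rho> n) \<zeta> \<partial>\<nu>) - of_real (measure \<nu> UNIV)" for n
  proof -
    have "(\<integral>\<zeta>. torus_dilation (\<lambda>z. h z - 1) (\<rho> n) \<zeta> \<partial>\<nu>) = (\<integral>\<zeta>. torus_dilation h (\<rho> n) \<zeta> - 1 \<partial>\<nu>)"
    proof (rule integral_cong_AE)
      \<comment> \<open>Off the torus the two sides are 0 and -1, so the identity holds only almost
        everywhere.\<close>
      show "AE \<zeta> in \<nu>. torus_dilation (\<lambda>z. h z - 1) (\<rho> n) \<zeta> = torus_dilation h (\<rho> n) \<zeta> - 1"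
        using AE_torus by eventually_elim (simp add: torus_dilation_def)
    qed measurable
    also have "\<dots> = (\<integral>\<zeta>. torus_dilation h (\<rho> n) \<zeta> \<partial>\<nu>) - (\<integral>\<zeta>. 1 \<partial>\<nu>)"
      using hbdd by (intro Bochner_Integration.integral_diff integrable_const_bound) auto
    finally show ?thesis by (simp add: scaleR_conv_of_real)
  qed
  have "(\<lambda>n. \<integral>\<zeta>. torus_dilation (\<lambda>z. h z - 1) (\<rho> n) \<zeta> \<partial>\<nu>) \<longlonglongrightarrow> 0 - of_real (measure \<nu> UNIV)"
    unfolding eq using conv by (intro tendsto_diff tendsto_const) simp
  \<comment> \<open>The functionals send \<open>h - 1\<close> to values tending to minus the total
    mass, although each value is bounded by \<open>B\<close> times the norm of
    \<open>h - 1\<close>.\<close>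
  then have "norm (0 - complex_of_real (measure \<nu> UNIV)) \<le> B * dirichlet_norm (\<lambda>z. h z - 1)"
    unfolding B_def
    by (rule LIMSEQ_le_const2[OF tendsto_norm]) (use norm_integral_dilation_le[OF gD \<rho> fin] in auto)
  also have "\<dots> \<le> B * \<epsilon>" using close B by (intro mult_left_mono) auto
  also have "\<dots> < measure \<nu> UNIV" using pos B by (simp add: \<epsilon>_def field_simps)
  finally show False by simp
qed

end
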